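(* Let $\mathsf{K}^c_n$ be a complete convex graph of order $n$, with edge adjacency defined by the edge-intersection criterion. Then its Grundy index satisfies $$\frac{n^2}{8}+\frac{n}{4}\le \Gamma'(\mathsf{K}^c_n).$$
   Context: A geometric graph is a drawing of a graph in the plane in which the vertices are points in general position (no three collinear) and every edge is the straight-line segment joining its endpoints. A complete convex graph $\mathsf{K}^c_n$ of order $n$ is a geometric graph of the complete graph $K_n$ whose $n$ vertices are in convex position. Two distinct edges cross if they meet at a point interior to both segments; they intersect if they share an endpoint or cross. Edge-intersection criterion: two distinct edges are adjacent if and only if they intersect. A Grundy $k$-coloring is an assignment of the colors $1,\dots,k$ to all the edges, with every color used, that is proper (no two adjacent edges have the same color) and such that for every pair of colors $i<j$, every edge of color $j$ is adjacent to at least one edge of color $i$. The Grundy index $\Gamma'(\mathsf{G})$ of a geometric graph $\mathsf{G}$ is the largest $k$ for which $\mathsf{G}$ has a Grundy $k$-coloring.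
   Formalization: The formal theorem assumes n ≥ 2: for n = 1 the graph has no edges, its Grundy index is 0, and the claimed bound 3/8 ≤ 0 is false. *)

theory Defs
  imports "HOL-Analysis.Analysis"
begin

type_synonym point = "real^2"

definition general_position :: "point set \<Rightarrow> bool" where
  "general_position V \<longleftrightarrow>
     (\<forall>p\<in>V. \<forall>q\<in>V. \<forall>r\<in>V. p \<noteq> q \<and> q \<noteq> r \<and> p \<noteq> r \<longrightarrow> \<not> collinear {p, q, r})"

definition convex_position :: "point set \<Rightarrow> bool" where
  "convex_position V \<longleftrightarrow> (\<forall>p\<in>V. p \<notin> convex hull (V - {p}))"

text \<open>An edge is the set of its two endpoints; the straight-line drawing is then determined.\<close>

definition geometric_graph :: "point set \<Rightarrow> point set set \<Rightarrow> bool" where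
  "geometric_graph V E \<longleftrightarrow>
     finite V \<and> general_position V \<and> E \<subseteq> {{p, q} | p q. p \<in> V \<and> q \<in> V \<and> p \<noteq> q}"

definition complete_convex_graph :: "nat \<Rightarrow> point set \<Rightarrow> point set set \<Rightarrow> bool" where
  "complete_convex_graph n V E \<longleftrightarrow>
     geometric_graph V E \<and> card V = n \<and> convex_position V \<and>
     E = {{p, q} | p q. p \<in> V \<and> q \<in> V \<and> p \<noteq> q}"

definition crosses :: "point set \<Rightarrow> point set \<Rightarrow> bool" where
  "crosses e f \<longleftrightarrow> e \<noteq> f \<and>
     (\<exists>a b c d. e = {a, b} \<and> f = {c, d} \<and> open_segment a b \<inter> open_segment c d \<noteq> {})"

definition edge_adjacent :: "point set \<Rightarrow> point set \<Rightarrow> bool" where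
  "edge_adjacent e f \<longleftrightarrow> e \<noteq> f \<and> (e \<inter> f \<noteq> {} \<or> crosses e f)"

definition grundy_coloring :: "point set set \<Rightarrow> nat \<Rightarrow> (point set \<Rightarrow> nat) \<Rightarrow> bool" where
  "grundy_coloring E k c \<longleftrightarrow>
     c ` E = {1..k} \<and>
     (\<forall>e\<in>E. \<forall>f\<in>E. edge_adjacent e f \<longrightarrow> c e \<noteq> c f) \<and>
     (\<forall>i\<in>{1..k}. \<forall>j\<in>{1..k}. i < j \<longrightarrow>
        (\<forall>e\<in>E. c e = j \<longrightarrow> (\<exists>f\<in>E. c f = i \<and> edge_adjacent e f)))"

text \<open>The set below is bounded by \<open>card E\<close> and nonempty (color greedily) for every finite \<open>E\<close>,
  so the maximum is meaningful for every geometric graph.\<close>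

definition grundy_index :: "point set set \<Rightarrow> nat" where
  "grundy_index E = Max {k. \<exists>c. grundy_coloring E k c}"

end

theory Submission
  imports Defs "HOL-Library.Nat_Bijection"
begin

text \<open>
  Number the points counterclockwise and call the number of steps between the endpoints of an edge
  its length. For a length \<open>l\<close> and an offset \<open>s \<le> l\<close>, cut the circular sequence of points, from
  the point \<open>s\<close> on, into as many blocks of \<open>l + 1\<close> consecutive points as fit; fewer than \<open>l + 1\<close>
  points are left over. The edges that join the first point of a block to its last one form a
  class of pairwise disjoint edges of length \<open>l\<close> (\<open>block_class\<close>). An edge with at least \<open>l\<close>
  steps between its endpoints on both sides cannot have both endpoints among the leftover points,
  and it can have both in one block only if it is the edge of that block. In all other cases it
  has exactly one endpoint in some block, so that it shares a point with the edge of that block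
  or crosses it (\<open>block_class_meets_long_edge\<close>). Hence short edges block long ones: in the order
  of increasing length, each edge of a class is adjacent to an edge of every earlier class
  (\<open>block_class_meets_later\<close>), and such a chain of classes is a Grundy coloring of the edges it
  contains. All other edges can be colored greedily without losing a color
  (\<open>grundy_index_ge_class_chain\<close>).

  Each length \<open>l\<close> with \<open>1 \<le> l < h = \<lfloor>n/2\<rfloor>\<close> gives \<open>l + 1\<close> classes, one for each offset. The
  length \<open>h\<close> gives the \<open>n - h\<close> offsets for which the edge from \<open>s\<close> to \<open>s + h\<close> does not wrap
  around; with more, a diameter of an even polygon would be listed twice. The total,
  \<open>h (h + 1) / 2 + (n - h) - 1\<close>, is at least \<open>n\<^sup>2/8 + n/4\<close>.

  The geometry enters only through the counterclockwise numbering, in which every increasing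
  triple of points within one turn is positively oriented (\<open>ex_ccw_cycle\<close>). From this sign
  pattern, interleaved edges cross and separated edges do not.
\<close>

section \<open>Grundy colorings from chains of classes\<close>

lemma edge_adjacent_sym: "edge_adjacent e f \<Longrightarrow> edge_adjacent f e"
  unfolding edge_adjacent_def crosses_def by (metis Int_commute)

text \<open>Give the new edge the least color missing among its neighbors: the smaller colors all
  occur there, so the new edge satisfies the Grundy condition, and no old edge changes. The color
  is at most \<open>k + 1\<close>, so the colors in use still form an initial segment.\<close>

lemma greedy_step:
  assumes c: "grundy_coloring F k c" and e: "e \<notin> F"
  shows "\<exists>k'\<ge>k. \<exists>c'. grundy_coloring (insert e F) k' c'"
proof -
  define N where "N = {c f | f. f \<in> F \<and> edge_adjacent e f}"
  define m where "m = (LEAST i. 1 \<le> i \<and> i \<notin> N)"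
  have img: "c ` F = {1..k}" using c by (simp add: grundy_coloring_def)
  have N: "N \<subseteq> {1..k}" using img by (auto simp: N_def)
  have "1 \<le> Suc k \<and> Suc k \<notin> N" using N by auto
  then have m: "1 \<le> m" "m \<notin> N" "m \<le> Suc k"
    unfolding m_def by (metis (mono_tags, lifting) LeastI, metis (mono_tags, lifting) LeastI,
      metis (mono_tags, lifting) Least_le)
  have below: "i \<in> N" if "1 \<le> i" "i < m" for i
    using not_less_Least[of i "\<lambda>i. 1 \<le> i \<and> i \<notin> N"] that by (auto simp: m_def)
  define c' where "c' = c(e := m)"
  have c'F: "c' f = c f" if "f \<in> F" for f using that e by (auto simp: c'_def)
  have c'e: "c' e = m" by (simp add: c'_def)
  have "c' ` insert e F = insert m {1..k}"
    using img c'F c'e by (metis image_cong image_insert)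
  also have "\<dots> = {1..max k m}" using m by auto
  finally have 1: "c' ` insert e F = {1..max k m}" .
  have new: "c f \<noteq> m" if "f \<in> F" "edge_adjacent e f" for f
    using that m(2) by (auto simp: N_def)
  have 2: "\<forall>g\<in>insert e F. \<forall>f\<in>insert e F. edge_adjacent g f \<longrightarrow> c' g \<noteq> c' f"
  proof (intro ballI impI)
    fix g f assume *: "g \<in> insert e F" "f \<in> insert e F" "edge_adjacent g f"
    have "g \<noteq> f" using *(3) by (simp add: edge_adjacent_def)
    with * show "c' g \<noteq> c' f"
      using new[of f] new[of g] edge_adjacent_sym[of g f] c'F c'e c
      unfolding grundy_coloring_def by (metis insertE)
  qed
  have 3: "\<exists>f\<in>insert e F. c' f = i \<and> edge_adjacent g f"
    if "1 \<le> i" "i < j" "g \<in> insert e F" "c' g = j" for i j g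
  proof (cases "g = e")
    case True
    then have "i \<in> N" using that below c'e by auto
    then show ?thesis using True c'F by (auto simp: N_def)
  next
    case False
    then have g: "g \<in> F" "c g = j" using that c'F by auto
    then have "j \<in> c ` F" by blast
    then have "j \<in> {1..k}" by (simp only: img)
    moreover from this have "i \<in> {1..k}" using that(1,2) by simp
    moreover have "\<forall>i\<in>{1..k}. \<forall>j\<in>{1..k}. i < j \<longrightarrow>
        (\<forall>e\<in>F. c e = j \<longrightarrow> (\<exists>f\<in>F. c f = i \<and> edge_adjacent e f))"
      using c unfolding grundy_coloring_def by blast
    ultimately have "\<exists>f\<in>F. c f = i \<and> edge_adjacent g f" using g \<open>i < j\<close> by blast
    then obtain f where "f \<in> F" "c f = i" "edge_adjacent g f" by blast
    then show ?thesis using c'F by auto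
  qed
  have 4: "\<forall>i\<in>{1..max k m}. \<forall>j\<in>{1..max k m}. i < j \<longrightarrow>
      (\<forall>g\<in>insert e F. c' g = j \<longrightarrow> (\<exists>f\<in>insert e F. c' f = i \<and> edge_adjacent g f))"
  proof (intro ballI impI)
    fix i j g
    assume "i \<in> {1..max k m}" "i < j" "g \<in> insert e F" "c' g = j"
    then show "\<exists>f\<in>insert e F. c' f = i \<and> edge_adjacent g f"
      by (intro 3) simp_all
  qed
  have "grundy_coloring (insert e F) (max k m) c'"
    unfolding grundy_coloring_def using 1 2 4 by (intro conjI)
  then show ?thesis by (metis max.cobounded1)
qed

lemma grundy_coloring_extend:
  assumes "finite D" "grundy_coloring F k c" 
  shows "\<exists>k'\<ge>k. \<exists>c'. grundy_coloring (F \<union> D) k' c'"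
  using assms(1)
proof induction
  case empty
  then show ?case using assms(2) by auto
next
  case (insert e D)
  then obtain k' c' where *: "k' \<ge> k" "grundy_coloring (F \<union> D) k' c'" by auto
  show ?case
  proof (cases "e \<in> F \<union> D")
    case True
    then show ?thesis using * by (metis Un_insert_right insert_absorb)
  next
    case False
    from greedy_step[OF *(2) this] *(1) show ?thesis
      by (metis Un_insert_right le_trans)
  qed
qed

text \<open>The Grundy index is monotone under passing to a subset of the edges, so that inconvenient
  edges can be left out of a construction.\<close>

lemma grundy_index_ge:
  assumes "finite E" "F \<subseteq> E" "grundy_coloring F k c"
  shows "k \<le> grundy_index E"
proof -
  have "F \<union> E = E" using assms(2) by auto
  then obtain k' c' where k': "k' \<ge> k" "grundy_coloring E k' c'"
    using grundy_coloring_extend[OF assms(1,3)] by auto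
  have "j \<le> card E" if "grundy_coloring E j d" for j d
    using that card_image_le[OF assms(1), of d] by (simp add: grundy_coloring_def)
  then have "{k. \<exists>c. grundy_coloring E k c} \<subseteq> {..card E}" by auto
  then have "finite {k. \<exists>c. grundy_coloring E k c}" by (rule finite_subset) simp
  then have "k' \<le> grundy_index E"
    unfolding grundy_index_def using k'(2) by (intro Max_ge) auto
  then show ?thesis using k'(1) by simp
qed

text \<open>The form in which colorings are built below: the classes \<open>M 1, \<dots>, M k\<close> become the colors.
  Their disjointness is a consequence of the other conditions, and they may leave edges uncovered.\<close>

lemma grundy_index_ge_class_chain:
  assumes fin: "finite E"
    and sub: "\<And>i. i \<in> {1..k} \<Longrightarrow> M i \<subseteq> E"
    and ne: "\<And>i. i \<in> {1..k} \<Longrightarrow> M i \<noteq> {}"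
    and indep: "\<And>i e f. i \<in> {1..k} \<Longrightarrow> e \<in> M i \<Longrightarrow> f \<in> M i \<Longrightarrow> \<not> edge_adjacent e f"
    and meets: "\<And>i j e. i \<in> {1..k} \<Longrightarrow> j \<in> {1..k} \<Longrightarrow> i < j \<Longrightarrow> e \<in> M j
                  \<Longrightarrow> \<exists>f\<in>M i. edge_adjacent e f"
  shows "k \<le> grundy_index E"
proof -
  \<comment> \<open>An edge in two classes would be adjacent to an edge of its own class.\<close>
  have disj: "i = j" if "i \<in> {1..k}" "j \<in> {1..k}" "e \<in> M i" "e \<in> M j" for i j e
  proof (cases i j rule: linorder_cases)
    case less
    then show ?thesis using meets[of i j e] indep[of i e] that by blast
  next
    case greater
    then show ?thesis using meets[of j i e] indep[of j e] that by blast
  qed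
  define F where "F = (\<Union>i\<in>{1..k}. M i)"
  define c where "c e = (THE i. i \<in> {1..k} \<and> e \<in> M i)" for e
  have c: "c e = i" if "i \<in> {1..k}" "e \<in> M i" for i e
    unfolding c_def using that disj by blast
  have cF: "c e \<in> {1..k} \<and> e \<in> M (c e)" if e: "e \<in> F" for e
  proof -
    obtain i where "i \<in> {1..k}" "e \<in> M i" using e by (auto simp: F_def)
    then show ?thesis using c[of i e] by simp
  qed
  have "c ` F = {1..k}"
  proof
    show "c ` F \<subseteq> {1..k}" using cF by auto
    show "{1..k} \<subseteq> c ` F"
    proof
      fix i assume i: "i \<in> {1..k}"
      then obtain e where "e \<in> M i" using ne by blast
      then show "i \<in> c ` F" using i c[of i e] by (auto simp: F_def intro!: image_eqI[of _ _ e])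
    qed
  qed
  moreover have "c e \<noteq> c f" if "e \<in> F" "f \<in> F" "edge_adjacent e f" for e f
    using that cF indep by metis
  moreover have "\<exists>f\<in>F. c f = i \<and> edge_adjacent e f"
    if ij: "i \<in> {1..k}" "j \<in> {1..k}" "i < j" "e \<in> F" "c e = j" for i j e
  proof -
    have "e \<in> M j" using cF ij by auto
    then obtain f where f: "f \<in> M i" "edge_adjacent e f" using meets ij by blast
    then have "f \<in> F" using ij by (auto simp: F_def)
    then show ?thesis using f c ij by blast
  qed
  ultimately have "grundy_coloring F k c" unfolding grundy_coloring_def by blast
  moreover have "F \<subseteq> E" unfolding F_def using sub by (intro UN_least)
  ultimately show ?thesis using grundy_index_ge fin by blast
qed

section \<open>Orientation of point triples\<close>

text \<open>Twice the signed area of the triangle \<open>a b c\<close>; positive for a counterclockwise triple.\<close>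

definition orient :: "point \<Rightarrow> point \<Rightarrow> point \<Rightarrow> real" where
  "orient a b c = (b$1 - a$1) * (c$2 - a$2) - (b$2 - a$2) * (c$1 - a$1)"

lemma orient_rotate: "orient a b c = orient b c a"
  by (simp add: orient_def algebra_simps)

lemma orient_zero_imp_collinear:
  assumes "orient a b c = 0"
  shows "collinear {a, b, c}"
proof (cases "a = c")
  case False
  have eq: "(b$1 - a$1) * (c$2 - a$2) = (b$2 - a$2) * (c$1 - a$1)"
    using assms by (simp add: orient_def)
  have "\<exists>u. b = u *\<^sub>R a + (1 - u) *\<^sub>R c"
  proof (cases "a$1 = c$1")
    case True
    then have "a$2 \<noteq> c$2" using False by (simp add: vec_eq_iff forall_2)
    moreover from this have "b$1 = a$1" using eq True by simp
    ultimately have b: "b$1 = c$1" "(b$2 - c$2)/(a$2 - c$2) * (a$2 - c$2) = b$2 - c$2"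
      using True by auto
    let ?u = "(b$2 - c$2)/(a$2 - c$2)"
    have 1: "b$1 = ?u * a$1 + (1 - ?u) * c$1" using b True by (simp add: algebra_simps)
    have 2: "b$2 = ?u * a$2 + (1 - ?u) * c$2" using b(2) by (simp only: algebra_simps)
    have "b = ?u *\<^sub>R a + (1 - ?u) *\<^sub>R c"
      using 1 2 by (simp add: vec_eq_iff forall_2)
    then show ?thesis ..
  next
    case ne: False
    let ?u = "(b$1 - c$1)/(a$1 - c$1)"
    have u: "?u * (a$1 - c$1) = b$1 - c$1" using ne by simp
    have 1: "b$1 = ?u * a$1 + (1 - ?u) * c$1" using u by (simp only: algebra_simps)
    have "(b$2 - c$2) * (a$1 - c$1) = (b$1 - c$1) * (a$2 - c$2)" using eq by (simp add: algebra_simps)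
    then have "b$2 - c$2 = ?u * (a$2 - c$2)" using ne by (simp add: field_simps)
    then have 2: "b$2 = ?u * a$2 + (1 - ?u) * c$2" by (simp only: algebra_simps)
    have "b = ?u *\<^sub>R a + (1 - ?u) *\<^sub>R c"
      using 1 2 by (simp add: vec_eq_iff forall_2)
    then show ?thesis ..
  qed
  then show ?thesis by (simp add: collinear_3_expand)
qed (simp add: collinear_3_expand)

lemma orient_affine:
  "orient a b ((1 - u) *\<^sub>R c + u *\<^sub>R d) = (1 - u) * orient a b c + u * orient a b d"
  by (simp add: orient_def algebra_simps)

lemma orient_open_segment_self:
  assumes "p \<in> open_segment a b"
  shows "orient a b p = 0"
proof -
  obtain u where "p = (1 - u) *\<^sub>R a + u *\<^sub>R b" using assms by (auto simp: in_segment)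
  then show ?thesis by (simp add: orient_affine) (simp add: orient_def)
qed

lemma open_segments_disjoint_same_side:
  assumes "(0 < orient a b c \<and> 0 < orient a b d) \<or> (orient a b c < 0 \<and> orient a b d < 0)"
  shows "open_segment a b \<inter> open_segment c d = {}"
proof (rule ccontr)
  assume "\<not> ?thesis"
  then obtain p where p: "p \<in> open_segment a b" "p \<in> open_segment c d" by auto
  obtain u where u: "0 < u" "u < 1" "p = (1 - u) *\<^sub>R c + u *\<^sub>R d"
    using p(2) by (auto simp: in_segment)
  have "(1 - u) * orient a b c + u * orient a b d = 0"
    using orient_open_segment_self[OF p(1)] u(3) orient_affine by simp
  with assms u show False
    by (smt (verit) mult_pos_pos mult_pos_neg)
qed

text \<open>The diagonals divide each other in the ratio of the areas of the triangles that they cut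
  off, and opposite triangles add up to the same quadrilateral; this gives both parameters of the
  common point explicitly.\<close>

lemma convex_quadrilateral_diagonals_meet:
  assumes "0 < orient a b c" "0 < orient b c d" "0 < orient a c d" "0 < orient a b d"
  shows "open_segment a c \<inter> open_segment b d \<noteq> {}"
proof -
  define S where "S = orient b c d + orient a b d"
  have S: "S = orient a c d + orient a b c" "0 < S"
    using assms by (auto simp: S_def orient_def algebra_simps)
  define u where "u = orient a b d / S"
  define w where "w = orient a b c / S"
  have u: "0 < u" "u < 1" using assms S(2) by (auto simp: u_def S_def)
  have w: "0 < w" "w < 1" using assms S by (auto simp: w_def)
  have nz: "a \<noteq> c" "b \<noteq> d" using assms by (auto simp: orient_def)
  have uS: "u * S = orient a b d" "w * S = orient a b c" using S(2) by (auto simp: u_def w_def)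
  have "S * ((1 - u) * a$i + u * c$i) = S * ((1 - w) * b$i + w * d$i)" if "i = 1 \<or> i = 2" for i :: 2
  proof -
    have "S * ((1 - u) * a$i + u * c$i) = (S - u * S) * a$i + (u * S) * c$i"
      by (simp add: algebra_simps)
    also have "\<dots> = (S - w * S) * b$i + (w * S) * d$i"
      unfolding uS using that by (auto simp: S_def orient_def algebra_simps)
    also have "\<dots> = S * ((1 - w) * b$i + w * d$i)" by (simp add: algebra_simps)
    finally show ?thesis .
  qed
  then have "(1 - u) *\<^sub>R a + u *\<^sub>R c = (1 - w) *\<^sub>R b + w *\<^sub>R d"
    using S(2) by (simp add: vec_eq_iff forall_2)
  moreover have "(1 - u) *\<^sub>R a + u *\<^sub>R c \<in> open_segment a c" using u nz by (auto simp: in_segment)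
  moreover have "(1 - w) *\<^sub>R b + w *\<^sub>R d \<in> open_segment b d" using w nz by (auto simp: in_segment)
  ultimately show ?thesis by auto
qed

text \<open>The three oriented areas are the barycentric coordinates of \<open>p\<close>, up to their sum.\<close>

lemma in_triangle_hull:
  assumes "0 < orient a b p" "0 < orient b c p" "0 < orient c a p"
  shows "p \<in> convex hull {a, b, c}"
proof -
  define S where "S = orient a b p + orient b c p + orient c a p"
  have S: "0 < S" using assms by (simp add: S_def)
  define x where "x = orient b c p / S"
  define y where "y = orient c a p / S"
  define z where "z = orient a b p / S"
  have nn: "0 \<le> x" "0 \<le> y" "0 \<le> z" using assms S by (auto simp: x_def y_def z_def)
  have "x + y + z = (orient b c p + orient c a p + orient a b p) / S"
    by (simp add: x_def y_def z_def add_divide_distrib)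
  then have sum: "x + y + z = 1" using S by (simp add: S_def)
  have xS: "S * x = orient b c p" "S * y = orient c a p" "S * z = orient a b p"
    using S by (auto simp: x_def y_def z_def)
  have "S * (p$i) = S * (x * a$i + y * b$i + z * c$i)" if "i = 1 \<or> i = 2" for i :: 2
  proof -
    have "S * (p$i) = orient b c p * a$i + orient c a p * b$i + orient a b p * c$i"
      using that by (auto simp: S_def orient_def algebra_simps)
    also have "\<dots> = S * (x * a$i + y * b$i + z * c$i)"
      unfolding xS[symmetric] by (simp add: algebra_simps)
    finally show ?thesis .
  qed
  then have "p = x *\<^sub>R a + y *\<^sub>R b + z *\<^sub>R c"
    using S by (simp add: vec_eq_iff forall_2)
  then show ?thesis using nn sum by (auto simp: convex_hull_3)
qed

section \<open>Cyclic labelling of a point set in convex position\<close>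

lemma enumerate_by_real_key:
  fixes key :: "'a \<Rightarrow> real"
  assumes "finite A" "inj_on key A"
  obtains w where "bij_betw w {..<card A} A"
    "\<And>i j. i < j \<Longrightarrow> j < card A \<Longrightarrow> key (w i) < key (w j)"
proof -
  define xs where "xs = sorted_list_of_set (key ` A)"
  have xs: "set xs = key ` A" "sorted_wrt (<) xs" "length xs = card A"
    using assms by (auto simp: xs_def card_image)
  define w where "w i = inv_into A key (xs ! i)" for i
  have nth: "xs ! i \<in> key ` A" if "i < card A" for i
    using that xs by (metis nth_mem)
  have w: "key (w i) = xs ! i" "w i \<in> A" if "i < card A" for i
    using nth[OF that] by (auto simp: w_def f_inv_into_f inv_into_into)
  have mono: "key (w i) < key (w j)" if "i < j" "j < card A" for i j
    using that w xs sorted_wrt_nth_less by fastforce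
  have "inj_on w {..<card A}"
    by (rule linorder_inj_onI) (use mono in fastforce)+
  moreover have "w ` {..<card A} \<subseteq> A" using w by auto
  ultimately have "bij_betw w {..<card A} A"
    by (metis assms(1) bij_betw_def card_image card_lessThan card_subset_eq)
  with mono show ?thesis using that by blast
qed

text \<open>Seen from one point \<open>p\<close> of \<open>V\<close>, all others lie in an open half-plane, since \<open>p\<close> is not in
  their convex hull; sorting them by slope makes all triples that contain \<open>p\<close> counterclockwise.
  Convex position then takes care of the remaining triples: if the middle point lay on the wrong
  side, it would be inside the triangle formed by \<open>p\<close> and the other two.\<close>

lemma ex_ccw_enumeration:
  assumes fin: "finite V" and gp: "general_position V" and cp: "convex_position V"
    and ne: "V \<noteq> {}"
  obtains w where "bij_betw w {..<card V} V"
    "\<And>i j k. i < j \<Longrightarrow> j < k \<Longrightarrow> k < card V \<Longrightarrow> 0 < orient (w i) (w j) (w k)"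
proof -
  obtain p where p: "p \<in> V" using ne by auto
  define A where "A = V - {p}"
  have finA: "finite A" using fin by (simp add: A_def)
  have "p \<notin> convex hull A" using cp p by (simp add: convex_position_def A_def)
  then obtain a b where ab: "inner a p < b" "\<And>x. x \<in> convex hull A \<Longrightarrow> b < inner a x"
    using separating_hyperplane_closed_point[of "convex hull A" p] finA
    by (auto simp: finite_imp_compact_convex_hull compact_imp_closed)
  have AV: "x \<in> V" "x \<noteq> p" if "x \<in> A" for x using that by (auto simp: A_def)
  have nondegenerate: "orient x y z \<noteq> 0"
    if "x \<in> V" "y \<in> V" "z \<in> V" "x \<noteq> y" "y \<noteq> z" "x \<noteq> z" for x y z
    using gp that orient_zero_imp_collinear[of x y z] unfolding general_position_def by metis
  \<comment> \<open>Coordinates relative to \<open>p\<close> along the normal \<open>a\<close> and perpendicular to it; \<open>f\<close> is positive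
    on \<open>A\<close>, so the slope \<open>g / f\<close> orders \<open>A\<close> by angle.\<close>
  define f where "f x = a$1 * (x$1 - p$1) + a$2 * (x$2 - p$2)" for x :: point
  define g where "g x = a$1 * (x$2 - p$2) - a$2 * (x$1 - p$1)" for x :: point
  have f: "0 < f x" if "x \<in> A" for x
  proof -
    have "inner a p < inner a x" using ab that by (meson hull_inc order.strict_trans)
    then show ?thesis by (simp add: f_def inner_vec_def sum_2 algebra_simps)
  qed
  have a0: "0 < (a$1)^2 + (a$2)^2" if "x \<in> A" for x
  proof -
    have "a \<noteq> 0" using f[OF that] by (auto simp: f_def)
    then have "a$1 \<noteq> 0 \<or> a$2 \<noteq> 0" by (simp add: vec_eq_iff forall_2)
    then show ?thesis by (simp add: sum_power2_gt_zero_iff)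
  qed
  define key where "key x = g x / f x" for x
  have cross: "f x * g y - g x * f y = ((a$1)^2 + (a$2)^2) * orient p x y" for x y
    by (simp add: f_def g_def orient_def power2_eq_square algebra_simps)
  have key_less: "key x < key y \<longleftrightarrow> 0 < orient p x y" if xy: "x \<in> A" "y \<in> A" for x y
  proof -
    have "key x < key y \<longleftrightarrow> 0 < f x * g y - g x * f y"
      using f[OF xy(1)] f[OF xy(2)] by (simp add: key_def field_simps)
    also have "\<dots> \<longleftrightarrow> 0 < orient p x y"
      unfolding cross using a0[OF xy(1)] by (simp add: zero_less_mult_iff)
    finally show ?thesis .
  qed
  have inj: "inj_on key A"
  proof (rule inj_onI, rule ccontr)
    fix x y assume xy: "x \<in> A" "y \<in> A" "key x = key y" "x \<noteq> y"
    then have "orient p x y \<noteq> 0"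
      using AV p by (intro nondegenerate) auto
    moreover have "\<not> 0 < orient p x y" "\<not> 0 < orient p y x"
      using key_less xy by force+
    moreover have "orient p y x = - orient p x y" by (simp add: orient_def)
    ultimately show False by simp
  qed
  obtain u where u: "bij_betw u {..<card A} A"
    "\<And>i j. i < j \<Longrightarrow> j < card A \<Longrightarrow> key (u i) < key (u j)"
    using enumerate_by_real_key[OF finA inj] by blast
  have cV: "card V = Suc (card A)" 
    unfolding A_def by (rule card.remove[OF fin p])
  define w where "w i = (case i of 0 \<Rightarrow> p | Suc j \<Rightarrow> u j)" for i
  have uA: "u i \<in> A" if "i < card A" for i
    using bij_betwE[OF u(1)] that by auto
  have "w ` {..<card V} = insert p (u ` {..<card A})"
    unfolding cV lessThan_Suc_eq_insert_0 by (simp add: w_def image_image)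
  also have "\<dots> = V" using u(1) p by (auto simp: bij_betw_def A_def)
  finally have img: "w ` {..<card V} = V" .
  then have bij: "bij_betw w {..<card V} V"
    by (simp add: bij_betw_def eq_card_imp_inj_on)
  have first: "0 < orient p (u i) (u j)" if "i < j" "j < card A" for i j
    using u(2)[OF that] key_less uA that by auto
  have "0 < orient (w i) (w j) (w k)" if ijk: "i < j" "j < k" "k < card V" for i j k
  proof (cases i)
    case 0
    obtain j' k' where "j = Suc j'" "k = Suc k'" using ijk by (cases j; cases k) auto
    then show ?thesis using first[of j' k'] ijk cV 0 by (simp add: w_def)
  next
    case (Suc i')
    obtain j' k' where jk: "j = Suc j'" "k = Suc k'" using ijk by (cases j; cases k) auto
    then have l: "i' < j'" "j' < k'" "k' < card A" using ijk Suc cV by auto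
    let ?x = "u i'" and ?y = "u j'" and ?z = "u k'"
    have mem: "?x \<in> A" "?y \<in> A" "?z \<in> A" using l uA by auto
    have dist: "?x \<noteq> ?y" "?y \<noteq> ?z" "?x \<noteq> ?z"
      using u(2)[of i' j'] u(2)[of j' k'] u(2)[of i' k'] l by auto
    have "orient ?x ?y ?z \<noteq> 0"
      using AV mem dist by (intro nondegenerate) auto
    moreover have "\<not> orient ?x ?y ?z < 0"
    proof
      \<comment> \<open>A clockwise triple would put its middle point inside a triangle with apex \<open>p\<close>.\<close>
      assume neg: "orient ?x ?y ?z < 0"
      have "orient ?x ?z ?y = - orient ?x ?y ?z" by (simp add: orient_def algebra_simps)
      moreover have "orient ?z p ?y = orient p ?y ?z" by (metis orient_rotate)
      ultimately have "?y \<in> convex hull {p, ?x, ?z}"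
        using neg first[of i' j'] first[of j' k'] l by (intro in_triangle_hull) auto
      moreover have "{p, ?x, ?z} \<subseteq> V - {?y}" using mem dist p by (auto simp: A_def)
      ultimately have "?y \<in> convex hull (V - {?y})" using hull_mono by blast
      then show False using cp mem by (auto simp: convex_position_def A_def)
    qed
    ultimately show ?thesis using Suc jk by (simp add: w_def)
  qed
  with bij show ?thesis using that by blast
qed

text \<open>The numbering is extended periodically to all natural numbers. A class with offset \<open>s\<close> can then
  be studied in the window from \<open>s\<close> to \<open>s + n\<close>, where all comparisons are linear and no index
  has to be reduced modulo \<open>n\<close>. Injectivity on a window does not follow from the orientation
  condition when \<open>n = 2\<close>.\<close>

definition ccw_cycle :: "nat \<Rightarrow> (nat \<Rightarrow> point) \<Rightarrow> bool" where
  "ccw_cycle n v \<longleftrightarrow>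
     (\<forall>i. v (i + n) = v i) \<and>
     (\<forall>i j. i < j \<and> j < i + n \<longrightarrow> v i \<noteq> v j) \<and>
     (\<forall>i j k. i < j \<and> j < k \<and> k < i + n \<longrightarrow> 0 < orient (v i) (v j) (v k))"

lemma ex_ccw_cycle:
  assumes "finite V" "general_position V" "convex_position V" "V \<noteq> {}"
  obtains v where "ccw_cycle (card V) v" "range v = V"
proof -
  let ?n = "card V"
  have n: "0 < ?n" using assms by (simp add: card_gt_0_iff)
  obtain w where w: "bij_betw w {..<?n} V"
    "\<And>i j k. i < j \<Longrightarrow> j < k \<Longrightarrow> k < ?n \<Longrightarrow> 0 < orient (w i) (w j) (w k)"
    using ex_ccw_enumeration[OF assms] by blast
  define v where "v i = w (i mod ?n)" for i
  \<comment> \<open>Modulo the number of points, a step from \<open>i\<close> of less than a full turn wraps around at most once.\<close>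
  have wrap: "j mod ?n = i mod ?n + (j - i) \<or>
     (j mod ?n + ?n = i mod ?n + (j - i))" if "i < j" "j < i + ?n" for i j
  proof -
    let ?r = "i mod ?n + (j - i)"
    have r: "?r < 2 * ?n" using that mod_less_divisor[OF n, of i] by linarith
    have "j mod ?n = ?r mod ?n"
      using that by (metis le_add_diff_inverse less_imp_le mod_add_left_eq)
    moreover have "?r mod ?n = (if ?r < ?n then ?r else ?r - ?n)"
      using r by (simp add: le_mod_geq)
    ultimately show ?thesis by auto
  qed
  have "v i \<noteq> v j" if "i < j" "j < i + ?n" for i j
  proof -
    have "i mod ?n \<noteq> j mod ?n" using wrap[OF that] that by auto
    then show ?thesis
      using w(1) n by (auto simp: v_def bij_betw_def inj_on_def)
  qed
  moreover have "0 < orient (v i) (v j) (v k)" if ijk: "i < j" "j < k" "k < i + ?n" for i j k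
  proof -
    let ?i = "i mod ?n" and ?j = "j mod ?n" and ?k = "k mod ?n"
    have lt: "?i < ?n" "?j < ?n" "?k < ?n" using n by auto
    have wj: "?j = ?i + (j - i) \<or> ?j + ?n = ?i + (j - i)" using wrap ijk by auto
    have wk: "?k = ?i + (k - i) \<or> ?k + ?n = ?i + (k - i)" using wrap ijk by auto
    consider "?i < ?j" "?j < ?k" | "?j < ?k" "?k < ?i" | "?k < ?i" "?i < ?j"
      using wj wk ijk lt by linarith
    then show ?thesis
    proof cases
      case 1 then show ?thesis using w(2) lt by (simp add: v_def)
    next
      case 2 then show ?thesis using w(2)[of ?j ?k ?i] lt by (metis v_def orient_rotate)
    next
      case 3 then show ?thesis using w(2)[of ?k ?i ?j] lt by (metis v_def orient_rotate)
    qed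
  qed
  ultimately have "ccw_cycle ?n v" by (simp add: ccw_cycle_def v_def)
  moreover have "range v = V"
  proof
    show "range v \<subseteq> V" using w(1) n by (auto simp: v_def bij_betw_def)
    show "V \<subseteq> range v"
    proof
      fix x assume "x \<in> V"
      then obtain i where "i < ?n" "x = w i" using w(1) by (auto simp: bij_betw_def)
      then have "x = v i" by (simp add: v_def)
      then show "x \<in> range v" by simp
    qed
  qed
  ultimately show ?thesis using that by blast
qed

section \<open>Adjacency read off a cyclic labelling\<close>

text \<open>The endpoints of an edge are an unordered pair, but the open segment depends only on that
  pair, so any naming of the endpoints decides crossing.\<close>

lemma crosses_iff:
  "crosses {a, b} {c, d} \<longleftrightarrow> {a, b} \<noteq> {c, d} \<and> open_segment a b \<inter> open_segment c d \<noteq> {}"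
proof -
  have *: "open_segment a b = open_segment a' b'" if "{a, b} = {a', b'}" for a b a' b' :: point
    using that by (metis doubleton_eq_iff open_segment_commute)
  show ?thesis unfolding crosses_def using * by metis
qed

lemma interleaved_adjacent:
  assumes v: "ccw_cycle n v" and "i < j" "j < k" "k < l" "l < i + n"
  shows "edge_adjacent {v i, v k} {v j, v l}"
proof -
  have o: "0 < orient (v x) (v y) (v z)" if "i \<le> x" "x < y" "y < z" "z \<le> l" for x y z
    using v that assms(5) unfolding ccw_cycle_def by (meson add_le_mono1 le_less_trans less_le_trans)
  have "v i \<noteq> v j" "v i \<noteq> v l" using v assms unfolding ccw_cycle_def by auto
  then have "{v i, v k} \<noteq> {v j, v l}" by (auto simp: doubleton_eq_iff)
  moreover have "open_segment (v i) (v k) \<inter> open_segment (v j) (v l) \<noteq> {}"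
    using assms by (intro convex_quadrilateral_diagonals_meet o) auto
  ultimately show ?thesis by (simp add: edge_adjacent_def crosses_iff)
qed

lemma separated_not_adjacent:
  assumes v: "ccw_cycle n v" and "i < j" "j < k" "k < l" "l < i + n"
  shows "\<not> edge_adjacent {v i, v j} {v k, v l}"
proof -
  have "0 < orient (v i) (v j) (v k)" "0 < orient (v i) (v j) (v l)"
    using v assms unfolding ccw_cycle_def by auto
  then have "open_segment (v i) (v j) \<inter> open_segment (v k) (v l) = {}"
    by (intro open_segments_disjoint_same_side) auto
  moreover have "v i \<noteq> v k" "v i \<noteq> v l" "v j \<noteq> v k" "v j \<noteq> v l"
    using v assms unfolding ccw_cycle_def by auto
  ultimately show ?thesis by (auto simp: edge_adjacent_def crosses_iff)
qed

section \<open>Block classes\<close>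

definition block_class :: "nat \<Rightarrow> (nat \<Rightarrow> point) \<Rightarrow> nat \<Rightarrow> nat \<Rightarrow> point set set" where
  "block_class n v l s =
     (\<lambda>t. {v (s + t * Suc l), v (s + t * Suc l + l)}) ` {..<n div Suc l}"

lemma block_end_bound:
  assumes "t < n div Suc l"
  shows "t * Suc l + l < n"
proof -
  have "Suc t * Suc l \<le> n div Suc l * Suc l" using assms by (intro mult_le_mono1) simp
  also have "\<dots> \<le> n" by (rule div_times_less_eq_dividend)
  finally show ?thesis by simp
qed

lemma block_class_independent:
  assumes v: "ccw_cycle n v" and l: "1 \<le> l"
    and ef: "e \<in> block_class n v l s" "f \<in> block_class n v l s"
  shows "\<not> edge_adjacent e f"
proof -
  have *: "\<not> edge_adjacent {v (s + t * Suc l), v (s + t * Suc l + l)}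
      {v (s + t' * Suc l), v (s + t' * Suc l + l)}"
    if "t < t'" "t' < n div Suc l" for t t'
  proof -
    have "Suc t * Suc l \<le> t' * Suc l" using that by (intro mult_le_mono1) simp
    then have "t * Suc l + l < t' * Suc l" by simp
    then show ?thesis using block_end_bound[OF that(2)] l
      by (intro separated_not_adjacent[OF v]) linarith+
  qed
  obtain t t' where t: "t < n div Suc l" "e = {v (s + t * Suc l), v (s + t * Suc l + l)}"
    "t' < n div Suc l" "f = {v (s + t' * Suc l), v (s + t' * Suc l + l)}"
    using ef by (auto simp: block_class_def)
  show ?thesis
  proof (cases t t' rule: linorder_cases)
    case less then show ?thesis using * t by blast
  next
    case equal then show ?thesis using t by (simp add: edge_adjacent_def)
  next
    case greater then show ?thesis using *[of t' t] t edge_adjacent_sym by blast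
  qed
qed

text \<open>Take the block that contains \<open>x\<close>; it exists because fewer than \<open>l + 1\<close> points are left
  over, and \<open>y\<close> is at least \<open>l\<close> steps further on. Either the edge is the edge of this block, which
  is excluded, or \<open>y\<close> lies beyond the block. In the latter case the edge shares an endpoint with the
  block's edge if \<open>x\<close> is the first or last point of the block, and crosses it otherwise.\<close>

lemma block_class_meets_long_edge:
  assumes v: "ccw_cycle n v" and l: "1 \<le> l"
    and xy: "s \<le> x" "x + l \<le> y" "y < s + n"
    and new: "\<And>t. t < n div Suc l \<Longrightarrow> x = s + t * Suc l \<Longrightarrow> y \<noteq> x + l"
  shows "\<exists>f\<in>block_class n v l s. edge_adjacent {v x, v y} f"
proof -
  \<comment> \<open>Number of the block and position within it.\<close>
  define t where "t = (x - s) div Suc l"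
  define r where "r = (x - s) mod Suc l"
  have "t * Suc l + r = x - s" unfolding t_def r_def by (rule div_mult_mod_eq)
  then have x: "x = s + t * Suc l + r" using xy by linarith
  have "r < Suc l" unfolding r_def by (rule mod_less_divisor) simp
  then have r: "r \<le> l" by simp
  have "t * Suc l + l < n" using xy x by linarith
  then have "Suc t * Suc l \<le> n" by simp
  then have t: "t < n div Suc l" by (simp add: less_eq_div_iff_mult_less_eq Suc_le_eq[symmetric] del: mult_Suc)
  let ?f = "{v (s + t * Suc l), v (s + t * Suc l + l)}"
  have inj: "v i \<noteq> v j" if "s \<le> i" "i < j" "j < s + n" for i j
    using v that unfolding ccw_cycle_def by (meson add_le_mono1 less_le_trans)
  have "edge_adjacent {v x, v y} ?f"
  proof (cases "r = 0")
    case True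
    then have "y \<noteq> x + l" using new[OF t] x by simp
    then have "v (x + l) \<noteq> v y" "v x \<noteq> v y" using xy l by (intro inj; linarith)+
    then show ?thesis using True x by (auto simp: edge_adjacent_def doubleton_eq_iff)
  next
    case False
    then have far: "s + t * Suc l + l < y" using xy x by linarith
    show ?thesis
    proof (cases "r = l")
      case True
      then have "v (s + t * Suc l) \<noteq> v y" using far xy by (intro inj) auto
      moreover have "v (s + t * Suc l) \<noteq> v x" using True x l xy by (intro inj) auto
      ultimately show ?thesis using True x by (auto simp: edge_adjacent_def doubleton_eq_iff)
    next
      case False
      have "edge_adjacent ?f {v x, v y}"
        using \<open>r \<noteq> 0\<close> False x r far xy by (intro interleaved_adjacent[OF v]) linarith+
      then show ?thesis by (rule edge_adjacent_sym)
    qed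
  qed
  then show ?thesis using t by (auto simp: block_class_def)
qed

text \<open>Both endpoints of the later edge have to be moved into the window that starts at \<open>s\<close>; the
  cases distinguish whether this turns an edge of length \<open>l'\<close> into one that spans \<open>l'\<close> or
  \<open>n - l'\<close> steps. Both numbers are at least \<open>l\<close>, as \<open>l \<le> l' \<le> n/2\<close>. The remaining point is that
  the edge is not itself in the earlier class. For \<open>l' = l\<close> the offset modulo \<open>l + 1\<close> tells the
  starting points apart; only a diameter of an even polygon could also occur with its endpoints
  exchanged, which the condition on \<open>s' + l'\<close> rules out.\<close>

lemma block_class_meets_later:
  assumes v: "ccw_cycle n v" and l: "1 \<le> l" and s: "s \<le> l"
    and l': "l' \<le> n div 2" and s': "s' \<le> l'" 
    and diam: "l' = n div 2 \<Longrightarrow> s' + l' < n"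
    and later: "l < l' \<or> (l = l' \<and> s < s')"
    and e: "e \<in> block_class n v l' s'"
  shows "\<exists>f\<in>block_class n v l s. edge_adjacent e f"
proof -
  obtain t' where t': "t' < n div Suc l'" and e': "e = {v (s' + t' * Suc l'), v (s' + t' * Suc l' + l')}"
    using e by (auto simp: block_class_def)
  let ?a = "s' + t' * Suc l'"
  have tl: "t' * Suc l' + l' < n" using block_end_bound[OF t'] .
  have per: "v (i + n) = v i" for i using v by (simp add: ccw_cycle_def)
  have ll: "l \<le> l'" "2 * l' \<le> n" using later l' by auto
  have an: "?a < n" using tl s' by linarith
  have sn: "s < n" using s ll tl by linarith
  \<comment> \<open>Edges of equal length in two classes differ in their starting points.\<close>
  have new: "l' = l \<Longrightarrow> ?a = s + t * Suc l \<Longrightarrow> False" for t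
  proof -
    assume *: "l' = l" "?a = s + t * Suc l"
    have "(s' + t' * Suc l) mod Suc l = (s + t * Suc l) mod Suc l" using * by metis
    then have "s' mod Suc l = s mod Suc l" by (metis mod_mult_self1)
    then show False using s s' * later by simp
  qed
  consider (in_in) "s \<le> ?a" "?a + l' < s + n" | (in_out) "s \<le> ?a" "s + n \<le> ?a + l'"
    | (out_in) "?a < s" "s \<le> ?a + l'" using s ll by linarith
  then show ?thesis
  proof cases
    case in_in
    have "\<exists>f\<in>block_class n v l s. edge_adjacent {v ?a, v (?a + l')} f"
      using in_in ll new by (intro block_class_meets_long_edge[OF v l]) auto
    then show ?thesis using e' by simp
  next
    case in_out
    define b where "b = ?a + l' - n"
    have b: "b + n = ?a + l'" using in_out by (simp add: b_def)
    have "\<exists>f\<in>block_class n v l s. edge_adjacent {v b, v ?a} f"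
    proof (intro block_class_meets_long_edge[OF v l])
      fix t assume t: "t < n div Suc l" "b = s + t * Suc l"
      show "?a \<noteq> b + l"
      proof
        assume "?a = b + l"
        then have eq: "l + l' = n" using b by linarith
        then have "l = l'" "n = 2 * l'" using ll by auto
        then have "t' = 0" using tl by (cases t') auto
        moreover have "l' = n div 2" using \<open>n = 2 * l'\<close> by simp
        ultimately show False using diam in_out by auto
      qed
    qed (use in_out b ll an in linarith)+
    moreover have "v b = v (?a + l')" using per b by metis
    ultimately show ?thesis using e' by (simp add: insert_commute)
  next
    case out_in
    have "\<exists>f\<in>block_class n v l s. edge_adjacent {v (?a + l'), v (?a + n)} f"
    proof (intro block_class_meets_long_edge[OF v l])
      fix t assume t: "t < n div Suc l" "?a + l' = s + t * Suc l"
      show "?a + n \<noteq> ?a + l' + l"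
      proof
        assume "?a + n = ?a + l' + l"
        then have "l = l'" using ll by linarith
        moreover from this have "s < s'" using later by simp
        ultimately show False using out_in by simp
      qed
    qed (use out_in ll sn in linarith)+
    then show ?thesis using e' per by (simp add: insert_commute)
  qed
qed

section \<open>Counting the classes\<close>

lemma triangle_mono: "i \<le> j \<Longrightarrow> triangle i \<le> triangle j"
  by (induction j rule: dec_induct) auto

text \<open>Colors are numbered along the rows of the triangle of all pairs \<open>(l, s)\<close> with \<open>s \<le> l\<close>:
  the pair \<open>(l, s)\<close> gets the number \<open>triangle l + s\<close>. The pair \<open>(0, 0)\<close> gets \<open>0\<close>, so the
  colors proper start at \<open>1\<close> with the length \<open>1\<close>.\<close>

lemma triangle_decode:
  obtains l s where "i = triangle l + s" "s \<le> l"
proof -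
  obtain s m where "prod_decode i = (s, m)" by fastforce
  then have "i = triangle (s + m) + s"
    using prod_decode_inverse[of i] by (simp add: prod_encode_def)
  then show ?thesis using that[of "s + m" s] by simp
qed

lemma triangle_plus_less_lex:
  assumes "triangle l + s < triangle l' + s'" "s' \<le> l'"
  shows "l < l' \<or> (l = l' \<and> s < s')"
proof (rule ccontr)
  assume *: "\<not> ?thesis"
  then have "l' < l" using assms by (metis nat_add_left_cancel_less linorder_neqE_nat)
  then have "triangle (Suc l') \<le> triangle l" by (intro triangle_mono) simp
  then show False using assms by simp
qed

lemma class_count_bound:
  assumes "n \<ge> 2"
  shows "(real n)\<^sup>2 / 8 + real n / 4 \<le> real (triangle (n div 2) + (n - n div 2) - 1)"
proof -
  define h where "h = n div 2"
  have tri: "real (triangle h) = real h * (real h + 1) / 2" for h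
    by (induction h) (auto simp: field_simps)
  have h: "1 \<le> h" using assms by (simp add: h_def)
  show ?thesis
  proof (cases "even n")
    case True
    then have n: "n = 2 * h" by (simp add: h_def)
    have k: "real (triangle h + (n - h) - 1) = real h * (real h + 1) / 2 + real h - 1"
      using h n by (simp add: tri of_nat_diff)
    show ?thesis unfolding h_def[symmetric] k unfolding n using h
      by (simp add: power2_eq_square field_simps)
  next
    case False
    then have n: "n = 2 * h + 1" by (simp add: h_def)
    have k: "real (triangle h + (n - h) - 1) = real h * (real h + 1) / 2 + real h"
      using h n by (simp add: tri)
    show ?thesis unfolding h_def[symmetric] k unfolding n using h
      by (simp add: power2_eq_square field_simps)
  qed
qed

theorem theorem1:
  fixes n :: nat and V :: "point set" and E :: "point set set"
  assumes "n \<ge> 2" and "complete_convex_graph n V E"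
  shows "(real n)\<^sup>2 / 8 + real n / 4 \<le> real (grundy_index E)"
proof -
  have V: "finite V" "general_position V" "convex_position V" "card V = n"
    and E: "E = {{p, q} | p q. p \<in> V \<and> q \<in> V \<and> p \<noteq> q}"
    using assms(2) by (auto simp: complete_convex_graph_def geometric_graph_def)
  have "V \<noteq> {}" using V assms(1) by auto
  then obtain v where v: "ccw_cycle n v" "range v = V"
    using ex_ccw_cycle V by metis
  have "E \<subseteq> Pow V" using E by auto
  then have finE: "finite E" using V(1) finite_subset by blast
  define h where "h = n div 2"
  \<comment> \<open>All rows before row \<open>h\<close> and the first \<open>n - h\<close> entries of row \<open>h\<close>, without the color \<open>0\<close>.\<close>
  define k where "k = triangle h + (n - h) - 1"
  define M where "M i = (let (s, m) = prod_decode i in block_class n v (s + m) s)" for i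
  have M: "\<exists>l s. i = triangle l + s \<and> s \<le> l \<and> 1 \<le> l \<and> l \<le> h \<and> (l = h \<longrightarrow> s + l < n)
      \<and> M i = block_class n v l s" if i: "i \<in> {1..k}" for i
  proof -
    obtain l s where ls: "i = triangle l + s" "s \<le> l" by (rule triangle_decode)
    have "i = prod_encode (s, l - s)" using ls by (simp add: prod_encode_def)
    then have "M i = block_class n v l s" using ls by (simp add: M_def)
    moreover have "l \<noteq> 0" using ls i by (cases l) auto
    moreover have "l \<le> h"
    proof (rule ccontr)
      assume "\<not> l \<le> h"
      then have "triangle (Suc h) \<le> triangle l" by (intro triangle_mono) simp
      moreover have "n - h \<le> Suc h" by (simp add: h_def)
      ultimately show False using ls i k_def by simp
    qed
    moreover have "s + l < n" if "l = h"
      using ls i assms(1) that unfolding k_def h_def by auto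
    ultimately show ?thesis using ls by (auto simp: Suc_le_eq)
  qed
  have "k \<le> grundy_index E"
  proof (rule grundy_index_ge_class_chain[OF finE, where M = M])
    fix i assume i: "i \<in> {1..k}"
    then obtain l s where ls: "1 \<le> l" "l \<le> h" "M i = block_class n v l s" using M by blast
    have "Suc l \<le> n" using ls assms(1) by (auto simp: h_def)
    then have "0 < n div Suc l" by (simp add: div_greater_zero_iff)
    then show "M i \<noteq> {}" by (auto simp: ls(3) block_class_def)
    have "v x \<noteq> v (x + l)" for x
      using v(1) ls(1) \<open>Suc l \<le> n\<close> unfolding ccw_cycle_def by auto
    then show "M i \<subseteq> E"
      using v(2) unfolding E ls(3) block_class_def by blast
    fix e f assume "e \<in> M i" "f \<in> M i"
    then show "\<not> edge_adjacent e f" using block_class_independent[OF v(1)] ls by metis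
  next
    fix i j e assume ij: "i \<in> {1..k}" "j \<in> {1..k}" "i < j" "e \<in> M j"
    obtain l s where ls: "i = triangle l + s" "s \<le> l" "1 \<le> l" "M i = block_class n v l s"
      using M[OF ij(1)] by blast
    obtain l' s' where ls': "j = triangle l' + s'" "s' \<le> l'" "l' \<le> h" "l' = h \<longrightarrow> s' + l' < n"
      "M j = block_class n v l' s'" using M[OF ij(2)] by blast
    have "l < l' \<or> (l = l' \<and> s < s')"
      using triangle_plus_less_lex[of l s l' s'] ls ls' ij(3) by simp
    then show "\<exists>f\<in>M i. edge_adjacent e f"
      unfolding ls(4) using ls ls' ij(4) h_def
      by (intro block_class_meets_later[OF v(1)]) auto
  qed
  moreover have "(real n)\<^sup>2 / 8 + real n / 4 \<le> real k"
    using class_count_bound[OF assms(1)] by (simp add: k_def h_def)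
  ultimately show ?thesis by linarith
qed

end
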